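(* For every positive integer $n$, $f(n,3,3)\le 2\lg n+6$, where $\lg$ denotes the logarithm in base $2$.
   Context: A $3$-digraph $G$ consists of a finite vertex set $V(G)$ and an edge set $E(G)$ whose elements are ordered triples of distinct vertices. A $(3,k)$-tournament is a $3$-digraph $G$ such that for every $3$-element set $S\subseteq V(G)$, exactly $k$ of the $6$ orderings of $S$ are edges of $G$. The tight path $P^{(3)}_s$ is the $3$-digraph with $s$ distinct vertices $v_1,\ldots,v_s$ whose edges are exactly the triples $(v_i,v_{i+1},v_{i+2})$, $1\le i\le s-2$ (no edges if $s<3$). A $3$-digraph $G$ contains $P^{(3)}_s$ if there is an injection of its vertices into $V(G)$ mapping edges to edges. $f(n,3,k)$ is the maximum integer $s$ such that every $n$-vertex $(3,k)$-tournament contains a copy of $P^{(3)}_s$. *)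

theory Defs
  imports Complex_Main
begin

record 'a digraph3 =
  verts :: "'a set"
  edges :: "('a \<times> 'a \<times> 'a) set"

definition is_digraph3 :: "'a digraph3 \<Rightarrow> bool" where
  "is_digraph3 G \<longleftrightarrow> finite (verts G) \<and>
     (\<forall>(x, y, z) \<in> edges G.
        x \<in> verts G \<and> y \<in> verts G \<and> z \<in> verts G \<and> x \<noteq> y \<and> y \<noteq> z \<and> x \<noteq> z)"

text \<open>For a three-element set, the condition \<open>{x, y, z} = S\<close> already forces the three
  entries to be distinct.\<close>

definition orderings3 :: "'a set \<Rightarrow> ('a \<times> 'a \<times> 'a) set" where
  "orderings3 S = {(x, y, z). {x, y, z} = S}"

definition is_tournament3 :: "nat \<Rightarrow> 'a digraph3 \<Rightarrow> bool" where
  "is_tournament3 k G \<longleftrightarrow> is_digraph3 G \<and>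
     (\<forall>S \<subseteq> verts G. card S = 3 \<longrightarrow> card (edges G \<inter> orderings3 S) = k)"

definition tight_path3 :: "nat \<Rightarrow> nat digraph3" where
  "tight_path3 s = \<lparr> verts = {..<s}, edges = {(i, i + 1, i + 2) | i. i + 2 < s} \<rparr>"

definition contains3 :: "'a digraph3 \<Rightarrow> 'b digraph3 \<Rightarrow> bool" where
  "contains3 G H \<longleftrightarrow> (\<exists>\<phi>. inj_on \<phi> (verts H) \<and> \<phi> ` verts H \<subseteq> verts G \<and>
     (\<forall>(x, y, z) \<in> edges H. (\<phi> x, \<phi> y, \<phi> z) \<in> edges G))"

definition guaranteed_path3 :: "nat \<Rightarrow> nat \<Rightarrow> nat \<Rightarrow> bool" where
  "guaranteed_path3 n k s \<longleftrightarrow>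
     (\<forall>G :: nat digraph3. is_tournament3 k G \<and> card (verts G) = n \<longrightarrow> contains3 G (tight_path3 s))"

text \<open>The quantity \<open>f(n,3,k)\<close>. Every finite 3-digraph is isomorphic to one whose vertices are
  natural numbers, so quantifying over \<^typ>\<open>nat digraph3\<close> loses nothing. The maximum exists
  whenever \<open>k \<le> 6\<close>, see \<open>f3_maximum\<close> below.\<close>

definition f3 :: "nat \<Rightarrow> nat \<Rightarrow> nat" where
  "f3 n k = (GREATEST s. guaranteed_path3 n k s)"

lemma orderings3_distinct:
  assumes "card {x, y, z} = 3"
  shows "x \<noteq> y" "y \<noteq> z" "x \<noteq> z"
  using assms by (simp_all add: card_insert_if split: if_splits)

lemma card_orderings3:
  assumes "card S = 3"
  shows "finite (orderings3 S)" "card (orderings3 S) = 6"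
proof -
  obtain a b c where S: "S = {a, b, c}" "a \<noteq> b" "b \<noteq> c" "a \<noteq> c"
    using assms by (auto simp: card_3_iff)
  let ?R = "{(a,b,c), (a,c,b), (b,a,c), (b,c,a), (c,a,b), (c,b,a)}"
  have iff: "(x, y, z) \<in> orderings3 S \<longleftrightarrow> (x, y, z) \<in> ?R" for x y z
  proof
    assume "(x, y, z) \<in> orderings3 S"
    then have "{x, y, z} = {a, b, c}" by (simp add: S(1) orderings3_def)
    then have "x \<in> {a, b, c}" "y \<in> {a, b, c}" "z \<in> {a, b, c}"
      by blast+
    moreover have "x \<noteq> y" "y \<noteq> z" "x \<noteq> z"
      using assms S(1) \<open>{x, y, z} = {a, b, c}\<close> orderings3_distinct[of x y z] by simp_all
    ultimately show "(x, y, z) \<in> ?R"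
      by (elim insertE emptyE) simp_all
  next
    assume "(x, y, z) \<in> ?R"
    then show "(x, y, z) \<in> orderings3 S"
      unfolding S(1) orderings3_def by auto
  qed
  have eq: "orderings3 S = ?R"
  proof (rule set_eqI)
    show "e \<in> orderings3 S \<longleftrightarrow> e \<in> ?R" for e
      by (cases e rule: prod_cases3) (simp only: iff)
  qed
  show "finite (orderings3 S)" unfolding eq by simp
  show "card (orderings3 S) = 6" unfolding eq using S(2-4) by simp
qed

lemma tournament3_exists:
  assumes "k \<le> 6"
  shows "\<exists>G :: nat digraph3. is_tournament3 k G \<and> card (verts G) = n"
proof -
  have "\<exists>C. C \<subseteq> orderings3 S \<and> card C = k" if "card S = 3" for S :: "nat set"
    using obtain_subset_with_card_n[of k "orderings3 S"] assms card_orderings3[OF that] by auto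
  then obtain C :: "nat set \<Rightarrow> (nat \<times> nat \<times> nat) set"
    where C: "\<And>S. card S = 3 \<Longrightarrow> C S \<subseteq> orderings3 S \<and> card (C S) = k"
    by metis
  define G where "G = \<lparr> verts = {..<n}, edges = (\<Union>S \<in> {S. S \<subseteq> {..<n} \<and> card S = 3}. C S) \<rparr>"
  have E: "S \<subseteq> {..<n} \<and> card S = 3 \<and> {x, y, z} = S \<and> (x, y, z) \<in> C S"
    if xyz: "(x, y, z) \<in> edges G" "S = {x, y, z}" for x y z S
  proof -
    obtain T where T: "T \<subseteq> {..<n}" "card T = 3" "(x, y, z) \<in> C T"
      using xyz(1) unfolding G_def by auto
    then have "(x, y, z) \<in> orderings3 T" using C by blast
    then have "T = S" using xyz(2) by (simp add: orderings3_def)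
    then show ?thesis using T xyz(2) by blast
  qed
  have "is_digraph3 G"
    unfolding is_digraph3_def
  proof (intro conjI ballI, goal_cases)
    case 1
    show ?case by (simp add: G_def)
  next
    case (2 e)
    obtain x y z where e: "e = (x, y, z)" by (cases e) auto
    have "{x, y, z} \<subseteq> {..<n}" "card {x, y, z} = 3"
      using E[of x y z] 2 e by auto
    moreover have "x \<noteq> y" "y \<noteq> z" "x \<noteq> z"
      using orderings3_distinct[OF \<open>card {x, y, z} = 3\<close>] by blast+
    ultimately show ?case
      unfolding e by (simp add: G_def)
  qed
  moreover have "edges G \<inter> orderings3 S = C S" if "S \<subseteq> verts G" "card S = 3" for S
  proof
    show "edges G \<inter> orderings3 S \<subseteq> C S"
      using E unfolding orderings3_def by blast
    have "C S \<subseteq> edges G" using that unfolding G_def by auto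
    then show "C S \<subseteq> edges G \<inter> orderings3 S" using C[OF that(2)] by blast
  qed
  ultimately have "is_tournament3 k G"
    unfolding is_tournament3_def using C by simp
  then show ?thesis by (intro exI[of _ G]) (simp add: G_def)
qed

lemma f3_maximum:
  assumes "k \<le> 6"
  shows "guaranteed_path3 n k (f3 n k)"
    and "guaranteed_path3 n k s \<Longrightarrow> s \<le> f3 n k"
proof -
  obtain G :: "nat digraph3" where G: "is_tournament3 k G" "card (verts G) = n"
    using tournament3_exists[OF assms] by blast
  have bound: "s \<le> n" if s: "guaranteed_path3 n k s" for s
  proof -
    obtain \<phi> where "inj_on \<phi> {..<s}" "\<phi> ` {..<s} \<subseteq> verts G"
      using s G unfolding guaranteed_path3_def contains3_def tight_path3_def digraph3.simps
      by blast
    moreover have "finite (verts G)"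
      using G unfolding is_tournament3_def is_digraph3_def by blast
    ultimately show ?thesis
      using card_inj_on_le[of \<phi> "{..<s}" "verts G"] G by simp
  qed
  have "guaranteed_path3 n k 0"
    by (simp add: guaranteed_path3_def contains3_def tight_path3_def)
  then show "guaranteed_path3 n k (f3 n k)"
    unfolding f3_def using bound by (rule GreatestI_nat)
  show "guaranteed_path3 n k s \<Longrightarrow> s \<le> f3 n k"
    unfolding f3_def using bound by (intro Greatest_le_nat) auto
qed

end

theory Submission
  imports Defs
begin

text \<open>
  Place the vertices on the leaves of a binary tree of depth \<open>K\<close> with \<open>n \<le> 2 ^ K < 2 n\<close>. An
  ordered pair \<open>(x, y)\<close> is labelled by the height \<open>h\<close> of its meet if \<open>x < y\<close>, and by \<open>K + h\<close> if
  \<open>x > y\<close>. Declaring \<open>(x, y, z)\<close> an edge iff the label of \<open>(x, y)\<close> is smaller than that of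
  \<open>(y, z)\<close> selects exactly three orderings of every triple. The labels of consecutive pairs
  increase along a tight path, and there are only \<open>2 K\<close> labels.
\<close>

text \<open>The leaves are the numbers themselves: \<open>x div 2 ^ j\<close> is the ancestor of
  leaf \<open>x\<close> at height \<open>j\<close>.\<close>

definition meet_height :: "nat \<Rightarrow> nat \<Rightarrow> nat" where
  "meet_height x y = (LEAST j. x div 2 ^ j = y div 2 ^ j)"

text \<open>Heights of distinct leaves below \<open>2 ^ K\<close> lie in \<open>1..K\<close>, so the
  shift by \<open>K\<close> puts every descending pair strictly above every ascending one.\<close>

definition pair_label :: "nat \<Rightarrow> nat \<Rightarrow> nat \<Rightarrow> nat" where
  "pair_label K x y = (if x < y then meet_height x y else K + meet_height y x)"

definition ascent_digraph :: "nat \<Rightarrow> nat \<Rightarrow> nat digraph3" where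
  "ascent_digraph K n = \<lparr> verts = {..<n},
     edges = {(x, y, z). x < n \<and> y < n \<and> z < n \<and> x \<noteq> y \<and> y \<noteq> z \<and> x \<noteq> z \<and>
       pair_label K x y < pair_label K y z} \<rparr>"

lemma div_power2_eq_mono:
  fixes x y :: nat
  assumes "x div 2 ^ i = y div 2 ^ i" "i \<le> j"
  shows "x div 2 ^ j = y div 2 ^ j"
  using assms by (metis div_mult2_eq le_add_diff_inverse power_add)

lemma meet_height_le_iff: "meet_height x y \<le> j \<longleftrightarrow> x div 2 ^ j = y div 2 ^ j"
proof
  \<comment> \<open>A common ancestor exists: \<open>2 ^ (x + y)\<close> exceeds both leaves, so at
    height \<open>x + y\<close> both quotients vanish.\<close>
  have "v div 2 ^ (x + y) = 0" if "v \<le> x + y" for v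
    using le_less_trans[OF that less_exp] by (rule div_less)
  then have "x div 2 ^ (x + y) = y div 2 ^ (x + y)"
    by simp
  then have "x div 2 ^ meet_height x y = y div 2 ^ meet_height x y"
    unfolding meet_height_def by (rule LeastI)
  then show "meet_height x y \<le> j \<Longrightarrow> x div 2 ^ j = y div 2 ^ j"
    by (rule div_power2_eq_mono)
  show "x div 2 ^ j = y div 2 ^ j \<Longrightarrow> meet_height x y \<le> j"
    unfolding meet_height_def by (rule Least_le)
qed

lemma meet_height_pos: "x \<noteq> y \<Longrightarrow> 0 < meet_height x y"
  using meet_height_le_iff[of x y 0] by auto

lemma meet_height_le: "x < 2 ^ K \<Longrightarrow> y < 2 ^ K \<Longrightarrow> meet_height x y \<le> K"
  by (simp add: meet_height_le_iff)

text \<open>Division is monotone, so the ancestor of \<open>y\<close> is squeezed between those of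
  \<open>x\<close> and \<open>z\<close>: the outer two agree at height \<open>j\<close> iff all
  three do.\<close>

lemma meet_height_outer:
  assumes "x < y" "y < z"
  shows "meet_height x z = max (meet_height x y) (meet_height y z)"
proof -
  have "meet_height x z \<le> j \<longleftrightarrow> max (meet_height x y) (meet_height y z) \<le> j" for j
    using div_le_mono[of x y "2 ^ j"] div_le_mono[of y z "2 ^ j"] assms
    by (auto simp: meet_height_le_iff)
  then show ?thesis
    by (meson le_antisym order_refl)
qed

text \<open>One level below a common height the three vertices would have three distinct ancestors,
  all children of the same node.\<close>

lemma meet_height_neq:
  assumes "x < y" "y < z"
  shows "meet_height x y \<noteq> meet_height y z"
proof
  assume eq: "meet_height x y = meet_height y z"
  obtain j where j: "meet_height x y = Suc j"
    using meet_height_pos[of x y] assms by (cases "meet_height x y") auto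
  have "x div 2 ^ j \<noteq> y div 2 ^ j" "y div 2 ^ j \<noteq> z div 2 ^ j"
    using eq j by (simp_all flip: meet_height_le_iff)
  moreover have "x div 2 ^ j \<le> y div 2 ^ j" "y div 2 ^ j \<le> z div 2 ^ j"
    using assms by (simp_all add: div_le_mono)
  moreover have "x div 2 ^ j div 2 = y div 2 ^ j div 2" "y div 2 ^ j div 2 = z div 2 ^ j div 2"
    using meet_height_le_iff[of x y "Suc j"] meet_height_le_iff[of y z "Suc j"] eq j
    by (simp_all flip: div_mult2_eq add: mult.commute)
  ultimately show False
    by linarith
qed

lemma pair_label_bounds:
  assumes "x < 2 ^ K" "y < 2 ^ K" "x \<noteq> y"
  shows "0 < pair_label K x y" "pair_label K x y \<le> 2 * K"
  using assms meet_height_pos[of x y] meet_height_pos[of y x]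
    meet_height_le[of x K y] meet_height_le[of y K x]
  by (auto simp: pair_label_def)

lemma orderings3_triple:
  assumes "x \<noteq> y" "y \<noteq> z" "x \<noteq> z"
  shows "orderings3 {x, y, z} = {(x,y,z), (x,z,y), (y,x,z), (y,z,x), (z,x,y), (z,y,x)}"
    (is "_ = ?R")
proof (rule sym, rule card_subset_eq)
  have "card {x, y, z} = 3"
    using assms by simp
  note this [THEN card_orderings3(1)] this [THEN card_orderings3(2)]
  moreover have "card ?R = 6"
    using assms by simp
  ultimately show "finite (orderings3 {x, y, z})" "card ?R = card (orderings3 {x, y, z})"
    by simp_all
  show "?R \<subseteq> orderings3 {x, y, z}"
    by (auto simp: orderings3_def)
qed

lemma obtain_sorted_triple:
  fixes S :: "nat set"
  assumes "card S = 3"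
  obtains x y z where "S = {x, y, z}" "x < y" "y < z"
proof -
  obtain a b c where S: "S = {a, b, c}" "a \<noteq> b" "b \<noteq> c" "a \<noteq> c"
    using assms by (auto simp: card_3_iff)
  then consider "a < b \<and> b < c" | "a < c \<and> c < b" | "b < a \<and> a < c" | "b < c \<and> c < a"
    | "c < a \<and> a < b" | "c < b \<and> b < a"
    by linarith
  then show ?thesis
  proof cases
    case 1 then show ?thesis using that[of a b c] S(1) by blast
  next
    case 2 then show ?thesis using that[of a c b] S(1) by blast
  next
    case 3 then show ?thesis using that[of b a c] S(1) by blast
  next
    case 4 then show ?thesis using that[of b c a] S(1) by blast
  next
    case 5 then show ?thesis using that[of c a b] S(1) by blast
  next
    case 6 then show ?thesis using that[of c b a] S(1) by blast
  qed
qed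

text \<open>For \<open>x < y < z\<close>, the two orderings with \<open>z\<close> in the middle go
  up then down and are always edges; the two with \<open>x\<close> in the middle go down then up and
  never are. Of \<open>(x,y,z)\<close> and \<open>(z,y,x)\<close> exactly one is an edge, since the
  heights of \<open>(x,y)\<close> and \<open>(y,z)\<close> differ.\<close>

lemma ascent_digraph_tournament:
  assumes "n \<le> 2 ^ K"
  shows "is_tournament3 3 (ascent_digraph K n)"
  unfolding is_tournament3_def
proof (intro conjI allI impI)
  show "is_digraph3 (ascent_digraph K n)"
    by (auto simp: is_digraph3_def ascent_digraph_def)
  fix S assume S: "S \<subseteq> verts (ascent_digraph K n)" "card S = 3"
  obtain x y z where xyz: "S = {x, y, z}" "x < y" "y < z"
    using S(2) by (rule obtain_sorted_triple)
  then have n: "x < n" "y < n" "z < n"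
    using S(1) by (auto simp: ascent_digraph_def)
  have h: "meet_height x y \<le> K" "meet_height y z \<le> K" "0 < meet_height x y" "0 < meet_height y z"
    using n assms xyz by (auto intro!: meet_height_le meet_height_pos)
  have O: "orderings3 S = {(x,y,z), (x,z,y), (y,x,z), (y,z,x), (z,x,y), (z,y,x)}"
    unfolding xyz(1) using xyz(2,3) by (intro orderings3_triple) auto
  have mem: "(a, b, c) \<in> edges (ascent_digraph K n) \<longleftrightarrow>
      a < n \<and> b < n \<and> c < n \<and> a \<noteq> b \<and> b \<noteq> c \<and> a \<noteq> c \<and> pair_label K a b < pair_label K b c"
    for a b c
    by (simp add: ascent_digraph_def)
  note outer = meet_height_outer[OF xyz(2,3)]
  consider "meet_height x y < meet_height y z" | "meet_height y z < meet_height x y"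
    using meet_height_neq[OF xyz(2,3)] by linarith
  then show "card (edges (ascent_digraph K n) \<inter> orderings3 S) = 3"
  proof cases
    case 1
    then have "edges (ascent_digraph K n) \<inter> orderings3 S = {(x,y,z), (x,z,y), (y,z,x)}"
      using n h xyz(2,3) by (simp add: O Int_insert_right mem pair_label_def outer)
    then show ?thesis
      using xyz(2,3) by simp
  next
    case 2
    then have "edges (ascent_digraph K n) \<inter> orderings3 S = {(x,z,y), (y,z,x), (z,y,x)}"
      using n h xyz(2,3) by (simp add: O Int_insert_right mem pair_label_def outer)
    then show ?thesis
      using xyz(2,3) by simp
  qed
qed

lemma ascent_digraph_path_length:
  assumes "n \<le> 2 ^ K" "contains3 (ascent_digraph K n) (tight_path3 s)"
  shows "s \<le> 2 * K + 1"
proof -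
  obtain \<phi> where inj: "inj_on \<phi> {..<s}" and range: "\<phi> ` {..<s} \<subseteq> {..<n}"
    and E: "\<forall>(x, y, z) \<in> {(i, i + 1, i + 2) | i. i + 2 < s}.
      (\<phi> x, \<phi> y, \<phi> z) \<in> edges (ascent_digraph K n)"
    using assms(2) unfolding contains3_def tight_path3_def digraph3.simps
    by (auto simp: ascent_digraph_def)
  have ascent: "pair_label K (\<phi> i) (\<phi> (i + 1)) < pair_label K (\<phi> (i + 1)) (\<phi> (i + 2))"
    if "i + 2 < s" for i
    using E that by (auto simp: ascent_digraph_def)
  have bounds: "0 < pair_label K (\<phi> i) (\<phi> (i + 1))" "pair_label K (\<phi> i) (\<phi> (i + 1)) \<le> 2 * K"
    if "i + 1 < s" for i
  proof -
    have "\<phi> j < 2 ^ K" if "j < s" for j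
      using that range assms(1) by (auto intro: less_le_trans)
    moreover have "\<phi> i \<noteq> \<phi> (i + 1)"
      using that inj_onD[OF inj, of i "i + 1"] by auto
    ultimately have "\<phi> i < 2 ^ K" "\<phi> (i + 1) < 2 ^ K" "\<phi> i \<noteq> \<phi> (i + 1)"
      using that by simp_all
    then show "0 < pair_label K (\<phi> i) (\<phi> (i + 1))" "pair_label K (\<phi> i) (\<phi> (i + 1)) \<le> 2 * K"
      by (rule pair_label_bounds)+
  qed
  \<comment> \<open>The first label is at least 1 and each later one is larger by at least
    1.\<close>
  have grow: "i < pair_label K (\<phi> i) (\<phi> (i + 1))" if "i + 1 < s" for i
    using that
  proof (induction i)
    case 0
    then show ?case using bounds(1)[of 0] by simp
  next
    case (Suc i)
    then show ?case using ascent[of i] by simp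
  qed
  \<comment> \<open>For \<open>s \<ge> 2\<close> the last consecutive pair has index
    \<open>s - 2\<close>, whence \<open>s - 2 < 2 * K\<close>; for smaller \<open>s\<close> the
    bound is trivial.\<close>
  show ?thesis
    using grow[of "s - 2"] bounds(2)[of "s - 2"] by linarith
qed

theorem theorem27:
  fixes n :: nat
  assumes "n > 0"
  shows "real (f3 n 3) \<le> 2 * log 2 (real n) + 6"
proof -
  \<comment> \<open>The least depth whose tree has at least \<open>n\<close> leaves. Rounding up
    adds at most 1 to the logarithm, so \<open>2 * K + 1\<close> is at most
    \<open>2 * log 2 n + 3\<close>.\<close>
  define K where "K = nat \<lceil>log 2 (real n)\<rceil>"
  have log: "0 \<le> log 2 (real n)"
    using assms by simp
  have "real n = 2 powr log 2 (real n)"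
    using assms by simp
  also have "\<dots> \<le> 2 powr real K"
    unfolding K_def by (intro powr_mono) linarith+
  also have "\<dots> = real (2 ^ K)"
    by (simp add: powr_realpow)
  finally have n: "n \<le> 2 ^ K"
    using of_nat_le_iff by blast
  have "contains3 (ascent_digraph K n) (tight_path3 (f3 n 3))"
    using f3_maximum(1)[of 3 n] ascent_digraph_tournament[OF n]
    by (simp add: guaranteed_path3_def ascent_digraph_def)
  then have "f3 n 3 \<le> 2 * K + 1"
    using n by (rule ascent_digraph_path_length[rotated])
  moreover have "real K \<le> log 2 (real n) + 1"
    using log unfolding K_def by linarith
  ultimately show ?thesis
    by linarith
qed

end
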